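(* Let $D$ be a finite set, $m\ge 1$, and let $X\subseteq D^{m}$ be non-degenerate and non-binary (i.e. $|D_j|>2$ for some $j\in[m]$), and suppose $X$ is totally blocked. Then: (a) $X$ is an impossibility domain with respect to IIA + Supportiveness + Non-dictatorship if and only if there is no supportive non-dictatorial IIA aggregator for $X$ with at most three voters (arity $n\le 3$); (b) $X$ is an impossibility domain with respect to IIA + Idempotency + Non-dictatorship if and only if there is no idempotent non-dictatorial IIA aggregator for $X$ with at most $|D|$ voters (arity $n\le |D|$).
   Context: A domain is a subset $X\subseteq D^m$; write $D_j=\mathrm{pr}_jX=\{x_j: x\in X\}$. For $n\ge1$, an IIA aggregator for $X$ of arity $n$ ($n$ voters) is a tuple $f=(f_1,\dots,f_m)$ of functions $f_j:D_j^n\to D_j$ such that for all $x^{(1)},\dots,x^{(n)}\in X$ the tuple $(f_1(x^{(1)}_1,\dots,x^{(n)}_1),\dots,f_m(x^{(1)}_m,\dots,x^{(n)}_m))$ lies in $X$. It is idempotent if $f_j(u,\dots,u)=u$ for all $j$ and $u\in D_j$; supportive if $f_j(u_1,\dots,u_n)\in\{u_1,\dots,u_n\}$ for all $j$ and all $u_i\in D_j$; a dictatorship if there is $k\in[n]$ with $f_j(u_1,\dots,u_n)=u_k$ for all $j$ and all $u_i\in D_j$, and non-dictatorial otherwise. $X$ is a possibility domain with respect to IIA + Idempotency (resp. Supportiveness) + Non-dictatorship if for some $n\ge2$ there is an idempotent (resp. supportive) non-dictatorial IIA aggregator for $X$ of arity $n$; otherwise it is an impossibility domain. $X$ is non-degenerate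 if $|D_j|>1$ for all $j$. Binary blockedness graph: for $Y\subseteq\{0,1\}^m$, a partial evaluation is $u:S\to\{0,1\}$ with $S\subseteq[m]$; it is a MIPE (minimally infeasible partial evaluation) if no element of $Y$ extends $u$, but for each $s\in S$ the partial evaluation obtained from $u$ by flipping the bit at $s$ extends to some element of $Y$. The blockedness graph of $Y$ is the directed graph on $[m]\times\{0,1\}$ with an edge from $(k,\sigma)$ to $(\ell,\rho)$, $k\neq\ell$, iff there is a MIPE $u:S\to\{0,1\}$ with $k,\ell\in S$, $u_k=\sigma$, $u_\ell=1-\rho$. Total blockedness (general): $X$ is totally blocked iff the following directed graph is strongly connected. Its vertices are the triples $\sigma\sigma'_j$ with $j\in[m]$, $\sigma,\sigma'\in D_j$, $\sigma\neq\sigma'$. There is an edge from $\sigma\sigma'_k$ to $\rho\rho'_\ell$ ($k\neq\ell$) iff there are sets $B_j\subseteq D_j$ ($j\in[m]$) with $|B_j|=2$ for all $j$, $B_k=\{\sigma,\sigma'\}$, $B_\ell=\{\rho,\rho'\}$, such that, letting $X_B=X\cap\prod_jB_j$ and regarding $X_B$ as a binary domain (identifying each $B_j$ with $\{0,1\}$), $(k,\sigma)$ is connected to $(\ell,\rho)$ (by an edge) in the blockedness graph of $X_B$. *)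

theory Defs
  imports "HOL-Library.FuncSet" "Graph_Theory.Graph_Theory"
begin

text \<open>
  Coordinates and voters are numbered from 0.  The set of \<open>m\<close>-tuples over \<open>D\<close> is
  \<open>{..<m} \<rightarrow>\<^sub>E D\<close>, so tuples are functions with the value \<open>undefined\<close> outside \<open>{..<m}\<close>.
\<close>

subsection \<open>Domains\<close>

definition coord_values :: "(nat \<Rightarrow> 'a) set \<Rightarrow> nat \<Rightarrow> 'a set" where
  "coord_values X j = (\<lambda>x. x j) ` X"

definition non_degenerate :: "nat \<Rightarrow> (nat \<Rightarrow> 'a) set \<Rightarrow> bool" where
  "non_degenerate m X \<longleftrightarrow> (\<forall>j<m. card (coord_values X j) > 1)"

definition non_binary :: "nat \<Rightarrow> (nat \<Rightarrow> 'a) set \<Rightarrow> bool" where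
  "non_binary m X \<longleftrightarrow> (\<exists>j<m. card (coord_values X j) > 2)"

subsection \<open>Aggregators\<close>

text \<open>
  The \<open>j\<close>-th component \<open>f j\<close> of an aggregator of arity \<open>n\<close> is only constrained on
  \<open>{..<n} \<rightarrow>\<^sub>E coord_values X j\<close>; its values elsewhere play no role.
\<close>

definition iia_aggregator ::
    "nat \<Rightarrow> (nat \<Rightarrow> 'a) set \<Rightarrow> nat \<Rightarrow> (nat \<Rightarrow> (nat \<Rightarrow> 'a) \<Rightarrow> 'a) \<Rightarrow> bool" where
  "iia_aggregator m X n f \<longleftrightarrow> n \<ge> 1 \<and>
     (\<forall>j<m. f j \<in> ({..<n} \<rightarrow>\<^sub>E coord_values X j) \<rightarrow> coord_values X j) \<and>
     (\<forall>x \<in> {..<n} \<rightarrow> X. (\<lambda>j\<in>{..<m}. f j (\<lambda>i\<in>{..<n}. x i j)) \<in> X)"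

definition idempotent ::
    "nat \<Rightarrow> (nat \<Rightarrow> 'a) set \<Rightarrow> nat \<Rightarrow> (nat \<Rightarrow> (nat \<Rightarrow> 'a) \<Rightarrow> 'a) \<Rightarrow> bool" where
  "idempotent m X n f \<longleftrightarrow>
     (\<forall>j<m. \<forall>a \<in> coord_values X j. f j (\<lambda>i\<in>{..<n}. a) = a)"

definition supportive ::
    "nat \<Rightarrow> (nat \<Rightarrow> 'a) set \<Rightarrow> nat \<Rightarrow> (nat \<Rightarrow> (nat \<Rightarrow> 'a) \<Rightarrow> 'a) \<Rightarrow> bool" where
  "supportive m X n f \<longleftrightarrow>
     (\<forall>j<m. \<forall>u \<in> {..<n} \<rightarrow>\<^sub>E coord_values X j. f j u \<in> u ` {..<n})"

definition dictatorship ::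
    "nat \<Rightarrow> (nat \<Rightarrow> 'a) set \<Rightarrow> nat \<Rightarrow> (nat \<Rightarrow> (nat \<Rightarrow> 'a) \<Rightarrow> 'a) \<Rightarrow> bool" where
  "dictatorship m X n f \<longleftrightarrow>
     (\<exists>k<n. \<forall>j<m. \<forall>u \<in> {..<n} \<rightarrow>\<^sub>E coord_values X j. f j u = u k)"

definition has_idem_nondict_aggregator :: "nat \<Rightarrow> (nat \<Rightarrow> 'a) set \<Rightarrow> nat \<Rightarrow> bool" where
  "has_idem_nondict_aggregator m X n \<longleftrightarrow>
     (\<exists>f. iia_aggregator m X n f \<and> idempotent m X n f \<and> \<not> dictatorship m X n f)"

definition has_supp_nondict_aggregator :: "nat \<Rightarrow> (nat \<Rightarrow> 'a) set \<Rightarrow> nat \<Rightarrow> bool" where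
  "has_supp_nondict_aggregator m X n \<longleftrightarrow>
     (\<exists>f. iia_aggregator m X n f \<and> supportive m X n f \<and> \<not> dictatorship m X n f)"

definition idempotent_possibility_domain :: "nat \<Rightarrow> (nat \<Rightarrow> 'a) set \<Rightarrow> bool" where
  "idempotent_possibility_domain m X \<longleftrightarrow> (\<exists>n\<ge>2. has_idem_nondict_aggregator m X n)"

definition supportive_possibility_domain :: "nat \<Rightarrow> (nat \<Rightarrow> 'a) set \<Rightarrow> bool" where
  "supportive_possibility_domain m X \<longleftrightarrow> (\<exists>n\<ge>2. has_supp_nondict_aggregator m X n)"

definition idempotent_impossibility_domain :: "nat \<Rightarrow> (nat \<Rightarrow> 'a) set \<Rightarrow> bool" where
  "idempotent_impossibility_domain m X \<longleftrightarrow> \<not> idempotent_possibility_domain m X"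

definition supportive_impossibility_domain :: "nat \<Rightarrow> (nat \<Rightarrow> 'a) set \<Rightarrow> bool" where
  "supportive_impossibility_domain m X \<longleftrightarrow> \<not> supportive_possibility_domain m X"

subsection \<open>Blockedness of binary domains\<close>

text \<open>
  Bits are Booleans, with \<open>1 - \<rho>\<close> rendered as \<open>\<not> \<rho>\<close>.  A partial evaluation on \<open>S\<close> is a
  map \<open>u\<close> with \<open>dom u = S\<close>.
\<close>

definition extends :: "(nat \<Rightarrow> bool) \<Rightarrow> (nat \<rightharpoonup> bool) \<Rightarrow> bool" where
  "extends y u \<longleftrightarrow> u \<subseteq>\<^sub>m (\<lambda>j. Some (y j))"

definition mipe :: "nat \<Rightarrow> (nat \<Rightarrow> bool) set \<Rightarrow> (nat \<rightharpoonup> bool) \<Rightarrow> bool" where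
  "mipe m Y u \<longleftrightarrow> dom u \<subseteq> {..<m} \<and>
     \<not> (\<exists>y\<in>Y. extends y u) \<and>
     (\<forall>s \<in> dom u. \<exists>y\<in>Y. extends y (u(s \<mapsto> \<not> the (u s))))"

definition binary_blockedness_graph ::
    "nat \<Rightarrow> (nat \<Rightarrow> bool) set \<Rightarrow> (nat \<times> bool) pair_pre_digraph" where
  "binary_blockedness_graph m Y =
     \<lparr> pverts = {..<m} \<times> UNIV,
       parcs = {((k, \<sigma>), (l, \<rho>)) | k \<sigma> l \<rho>. k < m \<and> l < m \<and> k \<noteq> l \<and>
         (\<exists>u. mipe m Y u \<and> u k = Some \<sigma> \<and> u l = Some (\<not> \<rho>))} \<rparr>"

subsection \<open>Total blockedness\<close>

text \<open>
  \<open>\<beta> j\<close> is the identification of the two-element set \<open>B j\<close> with the set of bits.  Exchanging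
  the two bits in some coordinates is an isomorphism of binary domains and of their blockedness
  graphs, so the edge condition below does not depend on which identifications are chosen.
\<close>

definition blocked_edge ::
    "nat \<Rightarrow> (nat \<Rightarrow> 'a) set \<Rightarrow> nat \<times> 'a \<times> 'a \<Rightarrow> nat \<times> 'a \<times> 'a \<Rightarrow> bool" where
  "blocked_edge m X = (\<lambda>(k, \<sigma>, \<sigma>') (l, \<rho>, \<rho>').
     k \<noteq> l \<and>
     (\<exists>B. (\<forall>j<m. B j \<subseteq> coord_values X j \<and> card (B j) = 2) \<and>
          B k = {\<sigma>, \<sigma>'} \<and> B l = {\<rho>, \<rho>'} \<and>
          (\<exists>\<beta> :: nat \<Rightarrow> 'a \<Rightarrow> bool. (\<forall>j<m. bij_betw (\<beta> j) (B j) UNIV) \<and>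
               ((k, \<beta> k \<sigma>), (l, \<beta> l \<rho>)) \<in> parcs (binary_blockedness_graph m
                  ((\<lambda>x. \<lambda>j\<in>{..<m}. \<beta> j (x j)) ` (X \<inter> (\<Pi>\<^sub>E j\<in>{..<m}. B j)))))))"

text \<open>The vertex \<open>(j, \<sigma>, \<sigma>')\<close> stands for the ordered pair \<open>\<sigma>\<sigma>'\<close> in coordinate \<open>j\<close>.\<close>

definition blockedness_graph ::
    "nat \<Rightarrow> (nat \<Rightarrow> 'a) set \<Rightarrow> (nat \<times> 'a \<times> 'a) pair_pre_digraph" where
  "blockedness_graph m X =
     (let V = {(j, \<sigma>, \<sigma>'). j < m \<and> \<sigma> \<in> coord_values X j \<and> \<sigma>' \<in> coord_values X j \<and> \<sigma> \<noteq> \<sigma>'}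
      in \<lparr> pverts = V, parcs = {(v, w). v \<in> V \<and> w \<in> V \<and> blocked_edge m X v w} \<rparr>)"

definition totally_blocked :: "nat \<Rightarrow> (nat \<Rightarrow> 'a) set \<Rightarrow> bool" where
  "totally_blocked m X \<longleftrightarrow> strongly_connected (with_proj (blockedness_graph m X))"

end

theory Submission
  imports Defs
begin

text \<open>
  Take a non-dictatorial aggregator of minimal arity \<open>n \<ge> 4\<close>.  By the argument of Swierczkowski's
  lemma it is a semiprojection: a fixed voter \<open>p\<close> decides whenever two voters agree in the
  coordinate under consideration.  If \<open>n > |D|\<close> this is always the case, which gives the
  idempotent half.  In the supportive half, nesting the semiprojection in itself yields one whose
  outcome is always the value of \<open>p\<close> or of a second voter \<open>q\<close>, and it is the value of \<open>q\<close> at some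
  tuple \<open>u\<close> of pairwise distinct values in some coordinate \<open>k\<close>.  An edge of the blockedness graph
  transports such a situation to its other end, for all values that the remaining voters can take
  there.  Follow a path from \<open>(k, u q, u p)\<close> to \<open>(k, u q, u r)\<close> for a third voter \<open>r\<close>: then \<open>q\<close>
  also decides when \<open>p\<close> and \<open>r\<close> both choose \<open>u r\<close>, although \<open>p\<close> should decide there.
\<close>

lemma coord_valuesI: "x \<in> X \<Longrightarrow> x j \<in> coord_values X j"
  by (simp add: coord_values_def)

subsection \<open>Composition of aggregators\<close>

text \<open>This is the superposition of operations, taken separately in each coordinate. With
  projections as the \<open>G i\<close> it renumbers or merges voters.\<close>

definition compose_aggregator ::
    "nat \<Rightarrow> (nat \<Rightarrow> (nat \<Rightarrow> 'a) \<Rightarrow> 'a) \<Rightarrow> (nat \<Rightarrow> nat \<Rightarrow> (nat \<Rightarrow> 'a) \<Rightarrow> 'a) \<Rightarrow>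
      nat \<Rightarrow> (nat \<Rightarrow> 'a) \<Rightarrow> 'a" where
  "compose_aggregator n f G j v = f j (\<lambda>i\<in>{..<n}. G i j v)"

lemma iia_aggregator_mem:
  assumes "iia_aggregator m X n f" "j < m" "u \<in> {..<n} \<rightarrow>\<^sub>E coord_values X j"
  shows "f j u \<in> coord_values X j"
  using assms by (auto simp: iia_aggregator_def)

lemma iia_aggregator_outcome:
  assumes "iia_aggregator m X n f" "\<And>i. i < n \<Longrightarrow> x i \<in> X"
  shows "(\<lambda>j\<in>{..<m}. f j (\<lambda>i\<in>{..<n}. x i j)) \<in> X"
  using assms by (auto simp: iia_aggregator_def)

text \<open>Each \<open>G i\<close> turns a profile of \<open>p\<close> voters into a tuple of
  \<open>X\<close>, and these \<open>n\<close> tuples form the profile to which \<open>f\<close> is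
  applied.\<close>

lemma iia_aggregator_compose:
  assumes f: "iia_aggregator m X n f" and "p \<ge> 1"
    and G: "\<And>i. i < n \<Longrightarrow> iia_aggregator m X p (G i)"
  shows "iia_aggregator m X p (compose_aggregator n f G)"
  unfolding iia_aggregator_def
proof (intro conjI allI impI ballI)
  show "p \<ge> 1" by fact
next
  fix j assume j: "j < m"
  show "compose_aggregator n f G j \<in> ({..<p} \<rightarrow>\<^sub>E coord_values X j) \<rightarrow> coord_values X j"
  proof
    fix v assume v: "v \<in> {..<p} \<rightarrow>\<^sub>E coord_values X j"
    have "G i j v \<in> coord_values X j" if "i < n" for i
      using iia_aggregator_mem[OF G[OF that] j v] .
    then have "(\<lambda>i\<in>{..<n}. G i j v) \<in> {..<n} \<rightarrow>\<^sub>E coord_values X j"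
      by auto
    then show "compose_aggregator n f G j v \<in> coord_values X j"
      unfolding compose_aggregator_def by (rule iia_aggregator_mem[OF f j])
  qed
next
  fix x assume x: "x \<in> {..<p} \<rightarrow> X"
  define y where "y i = (\<lambda>j\<in>{..<m}. G i j (\<lambda>h\<in>{..<p}. x h j))" for i
  have "y i \<in> X" if "i < n" for i
    unfolding y_def using iia_aggregator_outcome[OF G[OF that], of x] x by auto
  then have "(\<lambda>j\<in>{..<m}. f j (\<lambda>i\<in>{..<n}. y i j)) \<in> X"
    by (rule iia_aggregator_outcome[OF f])
  also have "(\<lambda>j\<in>{..<m}. f j (\<lambda>i\<in>{..<n}. y i j)) =
      (\<lambda>j\<in>{..<m}. compose_aggregator n f G j (\<lambda>i\<in>{..<p}. x i j))"
    by (intro restrict_ext) (simp add: compose_aggregator_def y_def)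
  finally show "(\<lambda>j\<in>{..<m}. compose_aggregator n f G j (\<lambda>i\<in>{..<p}. x i j)) \<in> X" .
qed

lemma idempotent_compose:
  assumes "idempotent m X n f" "\<And>i. i < n \<Longrightarrow> idempotent m X p (G i)"
  shows "idempotent m X p (compose_aggregator n f G)"
proof -
  have "(\<lambda>i\<in>{..<n}. G i j (\<lambda>i\<in>{..<p}. a)) = (\<lambda>i\<in>{..<n}. a)"
    if "j < m" "a \<in> coord_values X j" for j a
    using assms(2) that by (auto simp: idempotent_def fun_eq_iff restrict_def)
  with assms(1) show ?thesis
    by (auto simp: idempotent_def compose_aggregator_def)
qed

lemma supportive_compose:
  assumes f: "supportive m X n f" and G: "\<And>i. i < n \<Longrightarrow> supportive m X p (G i)"
  shows "supportive m X p (compose_aggregator n f G)"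
  unfolding supportive_def
proof (intro allI impI ballI)
  fix j u assume j: "j < m" and u: "u \<in> {..<p} \<rightarrow>\<^sub>E coord_values X j"
  let ?v = "\<lambda>i\<in>{..<n}. G i j u"
  have sub: "G i j u \<in> u ` {..<p}" if "i < n" for i
    using G[OF that] j u by (auto simp: supportive_def)
  have "?v \<in> {..<n} \<rightarrow>\<^sub>E coord_values X j"
    using sub u by (fastforce simp: PiE_iff)
  then have "f j ?v \<in> ?v ` {..<n}"
    using f j unfolding supportive_def by blast
  then show "compose_aggregator n f G j u \<in> u ` {..<p}"
    using sub by (auto simp: compose_aggregator_def)
qed

lemma projection_aggregator:
  assumes "X \<subseteq> {..<m} \<rightarrow>\<^sub>E D" "k < n"
  shows "iia_aggregator m X n (\<lambda>j v. v k)" "idempotent m X n (\<lambda>j v. v k)"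
    "supportive m X n (\<lambda>j v. v k)"
proof -
  have "(\<lambda>j\<in>{..<m}. x k j) \<in> X" if "x \<in> {..<n} \<rightarrow> X" for x
  proof -
    have "x k \<in> X" using that assms by auto
    then have "x k \<in> extensional {..<m}" using assms by (auto simp: PiE_iff)
    then show ?thesis using \<open>x k \<in> X\<close> by (simp add: extensional_restrict)
  qed
  then show "iia_aggregator m X n (\<lambda>j v. v k)"
    using assms(2) by (auto simp: iia_aggregator_def)
  show "idempotent m X n (\<lambda>j v. v k)" "supportive m X n (\<lambda>j v. v k)"
    using assms(2) by (auto simp: idempotent_def supportive_def)
qed

lemma supportive_imp_idempotent:
  assumes "supportive m X n f"
  shows "idempotent m X n f"
  unfolding idempotent_def
proof (intro allI impI ballI)
  fix j a assume "j < m" "a \<in> coord_values X j"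
  then have "f j (\<lambda>i\<in>{..<n}. a) \<in> (\<lambda>i\<in>{..<n}. a) ` {..<n}"
    using assms unfolding supportive_def by (metis PiE_iff restrict_PiE_iff)
  then show "f j (\<lambda>i\<in>{..<n}. a) = a" by auto
qed

text \<open>For a single voter, idempotency says that this voter dictates. The possibility notions
  demand \<open>n \<ge> 2\<close>, while the bounds on the arity in the theorem have no lower end;
  this fact reconciles the two.\<close>

lemma nondict_aggregator_arity:
  assumes "iia_aggregator m X n f" "idempotent m X n f" "\<not> dictatorship m X n f"
  shows "n \<ge> 2"
proof (rule ccontr)
  assume "\<not> n \<ge> 2"
  with assms(1) have n: "n = 1" by (auto simp: iia_aggregator_def)
  have "f j u = u 0" if "j < m" "u \<in> {..<n} \<rightarrow>\<^sub>E coord_values X j" for j u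
  proof -
    have "u = (\<lambda>i\<in>{..<n}. u 0)"
      using that n by (auto simp: fun_eq_iff PiE_iff extensional_def)
    moreover have "u 0 \<in> coord_values X j" using that n by auto
    ultimately show ?thesis using assms(2) that(1) unfolding idempotent_def by metis
  qed
  then show False using assms(3) n by (auto simp: dictatorship_def)
qed

subsection \<open>Semiprojections\<close>

definition semiprojection ::
    "nat \<Rightarrow> (nat \<Rightarrow> 'a) set \<Rightarrow> nat \<Rightarrow> nat \<Rightarrow> (nat \<Rightarrow> (nat \<Rightarrow> 'a) \<Rightarrow> 'a) \<Rightarrow> bool" where
  "semiprojection m X n p f \<longleftrightarrow> p < n \<and>
     (\<forall>j<m. \<forall>u \<in> {..<n} \<rightarrow>\<^sub>E coord_values X j. \<not> inj_on u {..<n} \<longrightarrow> f j u = u p)"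

lemma semiprojectionD:
  assumes "semiprojection m X n p f" "j < m" "u \<in> {..<n} \<rightarrow>\<^sub>E coord_values X j" "\<not> inj_on u {..<n}"
  shows "f j u = u p"
  using assms by (auto simp: semiprojection_def)

text \<open>
  Swierczkowski's lemma.  Only the outcomes at tuples with values in \<open>{a, b}\<close> in coordinate \<open>0\<close>
  enter the proof: the coalition deciding such a tuple is compared for different pairs \<open>c, d\<close>.
\<close>

lemma semiprojection_if_identified_dictators:
  assumes n: "n \<ge> 4" and m: "0 < m"
    and ab: "a \<in> coord_values X 0" "b \<in> coord_values X 0" "a \<noteq> b"
    and dict: "\<And>c d. c < n \<Longrightarrow> d < n \<Longrightarrow> c \<noteq> d \<Longrightarrow>
      \<exists>k<n. \<forall>j<m. \<forall>u \<in> {..<n} \<rightarrow>\<^sub>E coord_values X j. u c = u d \<longrightarrow> f j u = u k"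
  shows "\<exists>p. semiprojection m X n p f"
proof -
  obtain \<kappa> where \<kappa>: "\<And>c d. c < n \<Longrightarrow> d < n \<Longrightarrow> c \<noteq> d \<Longrightarrow> \<kappa> c d < n \<and>
      (\<forall>j<m. \<forall>u \<in> {..<n} \<rightarrow>\<^sub>E coord_values X j. u c = u d \<longrightarrow> f j u = u (\<kappa> c d))"
    using dict by metis
  \<comment> \<open>In \<open>w I\<close> the coalition \<open>I\<close> votes \<open>a\<close> and
    everybody else \<open>b\<close>; \<open>W\<close> consists of the winning coalitions, those that
    enforce \<open>a\<close>.\<close>
  define w where "w I = (\<lambda>i\<in>{..<n}. if i \<in> I then a else b)" for I
  define W where "W = {I. f 0 (w I) = a}"
  have W: "I \<in> W \<longleftrightarrow> \<kappa> c d \<in> I" if "c < n" "d < n" "c \<noteq> d" "c \<in> I \<longleftrightarrow> d \<in> I" for c d I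
  proof -
    have "w I \<in> {..<n} \<rightarrow>\<^sub>E coord_values X 0" "w I c = w I d"
      using ab that by (auto simp: w_def)
    then have "f 0 (w I) = w I (\<kappa> c d)" using \<kappa>[of c d] that m by blast
    then show ?thesis using \<kappa>[of c d] that ab by (auto simp: W_def w_def)
  qed
  have others: "\<exists>c d. c < n \<and> d < n \<and> c \<noteq> d \<and> c \<notin> {s, t} \<and> d \<notin> {s, t}" for s t
  proof -
    have "card ({..<n} - {s, t}) \<ge> 2"
      using n by (intro order_trans[OF _ diff_card_le_card_Diff]) (auto simp: card_insert_if)
    then obtain T where "T \<subseteq> {..<n} - {s, t}" "card T = 2"
      by (meson obtain_subset_with_card_n)
    then show ?thesis by (auto simp: card_2_iff)
  qed
  show ?thesis
  proof (cases "\<exists>p<n. {p} \<in> W")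
    case True
    then obtain p where p: "p < n" "{p} \<in> W" by auto
    have away: "\<kappa> c d = p" if "c < n" "d < n" "c \<noteq> d" "c \<noteq> p" "d \<noteq> p" for c d
      using W[of c d "{p}"] p that by auto
    \<comment> \<open>Either member of a pair containing \<open>p\<close> may be its dictator: the
      two cast the same vote whenever the pair is identified, so the outcome is still that of
      \<open>p\<close>.\<close>
    have close: "\<kappa> s t \<in> {s, t}" if "s < n" "t < n" "s \<noteq> t" "p \<in> {s, t}" for s t
    proof -
      obtain c d where cd: "c < n" "d < n" "c \<noteq> d" "c \<notin> {s, t}" "d \<notin> {s, t}"
        using others by metis
      then have "\<kappa> c d = p" using away that by auto
      then have "{s, t} \<in> W" using W[of c d "{s, t}"] cd that by auto
      then show ?thesis using W[of s t "{s, t}"] that by auto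
    qed
    have "f j u = u p" if j: "j < m" and u: "u \<in> {..<n} \<rightarrow>\<^sub>E coord_values X j" "\<not> inj_on u {..<n}" for j u
    proof -
      obtain c d where cd: "c < n" "d < n" "c \<noteq> d" "u c = u d"
        using u(2) by (auto simp: inj_on_def)
      then have "f j u = u (\<kappa> c d)" using \<kappa>[of c d] j u(1) by auto
      moreover have "u (\<kappa> c d) = u p"
        using away[of c d] close[of c d] cd by (cases "p \<in> {c, d}") auto
      ultimately show ?thesis by simp
    qed
    then show ?thesis using p by (auto simp: semiprojection_def)
  next
    case False
    \<comment> \<open>Without a winning singleton, each identified pair contains its own dictator.
      Then \<open>{0, 1}\<close> wins by the pair \<open>0, 1\<close> and loses by a pair disjoint
      from it.\<close>
    have close: "\<kappa> c d \<in> {c, d}" if "c < n" "d < n" "c \<noteq> d" for c d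
    proof (rule ccontr)
      assume "\<kappa> c d \<notin> {c, d}"
      then have "{\<kappa> c d} \<in> W" using W[of c d "{\<kappa> c d}"] that by auto
      then show False using \<kappa>[of c d] that False by blast
    qed
    obtain c d where cd: "c < n" "d < n" "c \<noteq> d" "c \<notin> {0, 1}" "d \<notin> {0, 1}"
      using others[of 0 1] by blast
    have "{0, 1} \<in> W" using W[of 0 1 "{0, 1}"] close[of 0 1] n by simp
    moreover have "{0, 1} \<notin> W" using W[of c d "{0, 1}"] close[of c d] cd by auto
    ultimately show ?thesis by simp
  qed
qed

text \<open>
  A tuple with \<open>u c = u d\<close> is \<open>v \<circ> e\<close>, where \<open>v\<close> omits entry \<open>d\<close> of \<open>u\<close> and \<open>e\<close> maps \<open>d\<close> to the
  new position of \<open>c\<close>.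
\<close>

lemma identified_dictator:
  assumes X: "X \<subseteq> {..<m} \<rightarrow>\<^sub>E D" and n: "n \<ge> 2"
    and cd: "c < n" "d < n" "c \<noteq> d"
    and dict: "\<And>e. (\<And>i. i < n \<Longrightarrow> e i < n - 1) \<Longrightarrow>
      dictatorship m X (n - 1) (compose_aggregator n f (\<lambda>i j v. v (e i)))"
  shows "\<exists>k<n. \<forall>j<m. \<forall>u \<in> {..<n} \<rightarrow>\<^sub>E coord_values X j. u c = u d \<longrightarrow> f j u = u k"
proof -
  \<comment> \<open>\<open>sk\<close> lists the voters other than \<open>d\<close> in increasing
    order; \<open>sh\<close> is its inverse away from \<open>d\<close>.\<close>
  define sk where "sk i = (if i < d then i else Suc i)" for i
  define sh where "sh i = (if i < d then i else i - 1)" for i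
  define e where "e i = (if i = d then sh c else sh i)" for i
  have sk: "sk i < n" if "i < n - 1" for i
    using that cd by (auto simp: sk_def)
  have sh: "sh i < n - 1" "sk (sh i) = i" if "i < n" "i \<noteq> d" for i
    using that cd by (auto simp: sk_def sh_def)
  have e: "e i < n - 1" if "i < n" for i
    using that cd sh by (auto simp: e_def)
  obtain k where k: "k < n - 1" and
    dk: "\<And>j v. j < m \<Longrightarrow> v \<in> {..<n - 1} \<rightarrow>\<^sub>E coord_values X j \<Longrightarrow>
      compose_aggregator n f (\<lambda>i j v. v (e i)) j v = v k"
    using dict[of e] e unfolding dictatorship_def by blast
  have "f j u = u (sk k)"
    if j: "j < m" and u: "u \<in> {..<n} \<rightarrow>\<^sub>E coord_values X j" "u c = u d" for j u
  proof -
    define v where "v = (\<lambda>i\<in>{..<n - 1}. u (sk i))"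
    have v: "v \<in> {..<n - 1} \<rightarrow>\<^sub>E coord_values X j"
      using u(1) sk by (auto simp: v_def)
    have "(\<lambda>i\<in>{..<n}. v (e i)) = u"
    proof
      fix i
      show "(\<lambda>i\<in>{..<n}. v (e i)) i = u i"
        using u e sh[of i] sh[of c] cd
        by (cases "i < n") (auto simp: v_def e_def PiE_iff extensional_def)
    qed
    then have "f j u = v k"
      using dk[OF j v] by (simp add: compose_aggregator_def)
    then show ?thesis using k by (simp add: v_def)
  qed
  then show ?thesis using sk[OF k] by blast
qed

text \<open>The assumption \<open>dict\<close> is what the absence of non-dictatorial aggregators
  with one voter less provides. Non-degeneracy supplies the two values \<open>a\<close> and
  \<open>b\<close> for Swierczkowski's lemma.\<close>

lemma semiprojection_of_minimal_arity:
  assumes X: "X \<subseteq> {..<m} \<rightarrow>\<^sub>E D" and m: "m \<ge> 1" and nd: "non_degenerate m X" and n: "n \<ge> 4"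
    and dict: "\<And>e. (\<And>i. i < n \<Longrightarrow> e i < n - 1) \<Longrightarrow>
      dictatorship m X (n - 1) (compose_aggregator n f (\<lambda>i j v. v (e i)))"
  shows "\<exists>p. semiprojection m X n p f"
proof -
  have "card (coord_values X 0) \<ge> 2"
    using nd m by (auto simp: non_degenerate_def Suc_le_eq numeral_2_eq_2)
  then obtain T where "T \<subseteq> coord_values X 0" "card T = 2"
    by (meson obtain_subset_with_card_n)
  then obtain a b where ab: "a \<in> coord_values X 0" "b \<in> coord_values X 0" "a \<noteq> b"
    by (auto simp: card_2_iff)
  show ?thesis
    using m n ab
    by (intro semiprojection_if_identified_dictators[OF n _ ab] identified_dictator[OF X _ _ _ _ dict]) auto
qed

subsection \<open>Transport along the blockedness graph\<close>

text \<open>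
  The infeasible evaluation is \<open>t\<close>; the tuples \<open>y\<close> and \<open>z\<close> extend it after flipping the bit at \<open>k\<close>
  and at \<open>l\<close>, respectively.  A tuple that coordinatewise agrees with \<open>y\<close> or \<open>z\<close>, with \<open>z\<close> at \<open>k\<close>
  and with \<open>y\<close> at \<open>l\<close>, would extend \<open>t\<close>.
\<close>

lemma blocked_edge_witnesses:
  assumes X: "X \<subseteq> {..<m} \<rightarrow>\<^sub>E D" and edge: "blocked_edge m X (k, \<sigma>, \<sigma>') (l, \<rho>, \<rho>')"
  obtains y z where "y \<in> X" "z \<in> X" "y k = \<sigma>'" "y l = \<rho>'" "z k = \<sigma>" "z l = \<rho>"
    "\<And>x. x \<in> X \<Longrightarrow> (\<And>j. j < m \<Longrightarrow> x j = y j \<or> x j = z j) \<Longrightarrow> x k = \<sigma> \<Longrightarrow> x l \<noteq> \<rho>'"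
proof -
  obtain B \<beta> t where kl: "k \<noteq> l" "k < m" "l < m"
    and B: "\<And>j. j < m \<Longrightarrow> card (B j) = 2"
    and Bk: "B k = {\<sigma>, \<sigma>'}" and Bl: "B l = {\<rho>, \<rho>'}"
    and \<beta>: "\<And>j. j < m \<Longrightarrow> bij_betw (\<beta> j) (B j) UNIV"
    and t: "mipe m ((\<lambda>x. \<lambda>j\<in>{..<m}. \<beta> j (x j)) ` (X \<inter> (\<Pi>\<^sub>E j\<in>{..<m}. B j))) t"
    and tk: "t k = Some (\<beta> k \<sigma>)" and tl: "t l = Some (\<not> \<beta> l \<rho>)"
    using edge by (auto simp: blocked_edge_def binary_blockedness_graph_def)
  define XB where "XB = X \<inter> (\<Pi>\<^sub>E j\<in>{..<m}. B j)"
  have dom: "dom t \<subseteq> {..<m}"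
    and infeasible: "\<And>x. x \<in> XB \<Longrightarrow> \<not> extends (\<lambda>j\<in>{..<m}. \<beta> j (x j)) t"
    and flip: "\<And>s. s \<in> dom t \<Longrightarrow> \<exists>x\<in>XB. extends (\<lambda>j\<in>{..<m}. \<beta> j (x j)) (t(s \<mapsto> \<not> the (t s)))"
    using t by (auto simp: mipe_def XB_def)
  have inj: "a = b \<longleftrightarrow> \<beta> j a = \<beta> j b" if "j < m" "a \<in> B j" "b \<in> B j" for j a b
    using \<beta>[OF that(1)] that(2,3) by (auto simp: bij_betw_def inj_on_def)
  have ne: "\<sigma> \<noteq> \<sigma>'" "\<rho> \<noteq> \<rho>'"
    using B[of k] B[of l] Bk Bl kl by auto
  \<comment> \<open>Negating a bit exchanges the two values of a coordinate, so \<open>t\<close>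
    prescribes \<sigma> at \<open>k\<close> and \<rho>' at \<open>l\<close>.\<close>
  have \<beta>ne: "\<beta> k \<sigma>' = (\<not> \<beta> k \<sigma>)" "\<beta> l \<rho>' = (\<not> \<beta> l \<rho>)"
    using inj[of k \<sigma> \<sigma>'] inj[of l \<rho> \<rho>'] ne Bk Bl kl by auto
  have ext: "extends (\<lambda>j\<in>{..<m}. \<beta> j (x j)) t' \<longleftrightarrow> (\<forall>j c. t' j = Some c \<longrightarrow> \<beta> j (x j) = c)"
    if "dom t' \<subseteq> {..<m}" for x t'
    using that by (fastforce simp: extends_def map_le_def dom_def subset_iff)
  have flipped: "\<exists>x\<in>XB. \<beta> s (x s) = (\<not> the (t s)) \<and> (\<forall>j c. j \<noteq> s \<longrightarrow> t j = Some c \<longrightarrow> \<beta> j (x j) = c)"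
    if "s \<in> dom t" for s
  proof -
    obtain x where x: "x \<in> XB" "extends (\<lambda>j\<in>{..<m}. \<beta> j (x j)) (t(s \<mapsto> \<not> the (t s)))"
      using flip[of s] \<open>s \<in> dom t\<close> by blast
    have "dom (t(s \<mapsto> \<not> the (t s))) \<subseteq> {..<m}" using dom that by auto
    from x(2)[unfolded ext[OF this]]
    have "\<beta> s (x s) = (\<not> the (t s))" "\<And>j c. j \<noteq> s \<Longrightarrow> t j = Some c \<Longrightarrow> \<beta> j (x j) = c"
      by auto
    with x(1) show ?thesis by blast
  qed
  obtain y where y: "y \<in> XB" "\<beta> k (y k) = (\<not> the (t k))"
    and yt: "\<And>j c. j \<noteq> k \<Longrightarrow> t j = Some c \<Longrightarrow> \<beta> j (y j) = c"
    using flipped[of k] tk by blast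
  obtain z where z: "z \<in> XB" "\<beta> l (z l) = (\<not> the (t l))"
    and zt: "\<And>j c. j \<noteq> l \<Longrightarrow> t j = Some c \<Longrightarrow> \<beta> j (z j) = c"
    using flipped[of l] tl by blast
  have mem: "x j \<in> B j" if "x \<in> XB" "j < m" for x j
    using that by (auto simp: XB_def)
  show thesis
  proof (rule that[of y z])
    show "y \<in> X" "z \<in> X" using y z by (auto simp: XB_def)
    show "y k = \<sigma>'" using inj[of k "y k" \<sigma>'] mem[OF y(1), of k] y(2) tk \<beta>ne Bk kl by auto
    show "z l = \<rho>" using inj[of l "z l" \<rho>] mem[OF z(1), of l] z(2) tl \<beta>ne Bl kl by auto
    show "y l = \<rho>'" using inj[of l "y l" \<rho>'] mem[OF y(1), of l] yt[of l] tl \<beta>ne Bl kl by auto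
    show "z k = \<sigma>" using inj[of k "z k" \<sigma>] mem[OF z(1), of k] zt[of k] tk \<beta>ne Bk kl by auto
    fix x assume x: "x \<in> X" "\<And>j. j < m \<Longrightarrow> x j = y j \<or> x j = z j" "x k = \<sigma>"
    have "x \<in> XB"
      using x(1) X x(2) mem[OF y(1)] mem[OF z(1)] by (force simp: XB_def PiE_iff)
    show "x l \<noteq> \<rho>'"
    proof
      assume xl: "x l = \<rho>'"
      \<comment> \<open>Away from \<open>k\<close> and \<open>l\<close> both \<open>y\<close> and
        \<open>z\<close> satisfy \<open>t\<close>, hence so does \<open>x\<close>; at
        \<open>k\<close> and \<open>l\<close> the values of \<open>x\<close> are the prescribed
        ones.\<close>
      have "\<beta> j (x j) = c" if "t j = Some c" for j c
      proof -
        have "j < m" using that dom by auto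
        then show ?thesis
          using that x(2)[of j] yt[of j c] zt[of j c] x(3) xl tk tl \<beta>ne
          by (cases "j = k"; cases "j = l") auto
      qed
      then show False
        using infeasible[OF \<open>x \<in> XB\<close>] ext[OF dom] by blast
    qed
  qed
qed

text \<open>Replace the vote of \<open>q\<close> by the outcome of \<open>f\<close> and apply
  \<open>f\<close> again. If \<open>f\<close> had chosen the value of \<open>q\<close>, nothing
  changes. Otherwise \<open>q\<close> now repeats the vote of another voter, so \<open>p\<close>,
  whose own vote is untouched, decides.\<close>

lemma semiprojection_two_valued:
  assumes X: "X \<subseteq> {..<m} \<rightarrow>\<^sub>E D" and f: "iia_aggregator m X n f" "supportive m X n f"
    and semi: "semiprojection m X n p f" and q: "q < n" "q \<noteq> p"
  obtains g where "iia_aggregator m X n g" "semiprojection m X n p g"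
    "\<And>j v. j < m \<Longrightarrow> v \<in> {..<n} \<rightarrow>\<^sub>E coord_values X j \<Longrightarrow> g j v = v p \<or> g j v = v q"
    "\<And>j v. j < m \<Longrightarrow> v \<in> {..<n} \<rightarrow>\<^sub>E coord_values X j \<Longrightarrow> f j v = v q \<Longrightarrow> g j v = v q"
proof -
  have p: "p < n" using semi by (simp add: semiprojection_def)
  define g where "g = compose_aggregator n f (\<lambda>i. if i = q then f else (\<lambda>j v. v i))"
  have g: "g j v = f j (v(q := f j v))" if "v \<in> {..<n} \<rightarrow>\<^sub>E coord_values X j" for j v
  proof -
    have "(\<lambda>i\<in>{..<n}. (if i = q then f else (\<lambda>j v. v i)) j v) = v(q := f j v)"
      using that q by (auto simp: fun_eq_iff PiE_iff extensional_def)
    then show ?thesis by (simp add: g_def compose_aggregator_def)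
  qed
  have keep: "g j v = v q" if "v \<in> {..<n} \<rightarrow>\<^sub>E coord_values X j" "f j v = v q" for j v
    using g[OF that(1)] that(2) by (metis fun_upd_triv)
  have other: "g j v = v p"
    if j: "j < m" and v: "v \<in> {..<n} \<rightarrow>\<^sub>E coord_values X j" and i: "i < n" "i \<noteq> q" "f j v = v i" for i j v
  proof -
    have "v(q := f j v) \<in> {..<n} \<rightarrow>\<^sub>E coord_values X j"
      using v i q by (auto simp: PiE_iff extensional_def)
    moreover have "(v(q := f j v)) q = (v(q := f j v)) i" using i by simp
    then have "\<not> inj_on (v(q := f j v)) {..<n}"
      using i q unfolding inj_on_def by blast
    ultimately show ?thesis
      using semiprojectionD[OF semi j] g[OF v] q by auto
  qed
  show thesis
  proof (rule that)
    show "iia_aggregator m X n g"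
      unfolding g_def using f(1) p projection_aggregator[OF X]
      by (intro iia_aggregator_compose) auto
    show "semiprojection m X n p g"
      \<comment> \<open>At a tuple with a repeated value \<open>f\<close> chooses the value of
        \<open>p\<close>, which is the case \<open>i = p\<close> of \<open>other\<close>.\<close>
      unfolding semiprojection_def
      using p q other[of _ _ p] semiprojectionD[OF semi] by auto
    show "g j v = v q" if "j < m" "v \<in> {..<n} \<rightarrow>\<^sub>E coord_values X j" "f j v = v q" for j v
      using keep that by blast
    show "g j v = v p \<or> g j v = v q" if "j < m" "v \<in> {..<n} \<rightarrow>\<^sub>E coord_values X j" for j v
    proof -
      have "f j v \<in> v ` {..<n}" using f(2) that by (auto simp: supportive_def)
      then obtain i where "i < n" "f j v = v i" by auto
      then show ?thesis using keep[OF that(2)] other[OF that, of i] by (cases "i = q") auto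
    qed
  qed
qed

text \<open>
  \<open>V h\<close> collects values that voter \<open>h\<close> can take in coordinate \<open>l\<close> along a path from \<open>k\<close> to \<open>l\<close>
  starting with the value \<open>u h\<close>.
\<close>

definition transported ::
    "(nat \<Rightarrow> 'a) set \<Rightarrow> nat \<Rightarrow> nat \<Rightarrow> nat \<Rightarrow> (nat \<Rightarrow> (nat \<Rightarrow> 'a) \<Rightarrow> 'a) \<Rightarrow>
      nat \<Rightarrow> (nat \<Rightarrow> 'a) \<Rightarrow> nat \<times> 'a \<times> 'a \<Rightarrow> bool" where
  "transported X n p q g k u = (\<lambda>(l, \<rho>, \<rho>'). \<exists>V.
     (\<forall>h<n. \<forall>x\<in>X. x k = u h \<longrightarrow> x l \<in> V h) \<and>
     (\<forall>v \<in> {..<n} \<rightarrow>\<^sub>E coord_values X l. v p = \<rho>' \<longrightarrow> v q = \<rho> \<longrightarrow>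
        (\<forall>h<n. h \<noteq> p \<longrightarrow> h \<noteq> q \<longrightarrow> v h \<in> V h) \<longrightarrow> g l v = \<rho>))"

text \<open>Let \<open>p\<close> vote \<open>y\<close> and \<open>q\<close> vote \<open>z\<close>,
  the two witnesses of the edge. By \<open>two\<close> the outcome agrees with \<open>y\<close> or
  \<open>z\<close> everywhere, and by \<open>tr\<close> it has \<sigma> at \<open>i\<close>;
  blockedness then rules out \<rho>' at \<open>l\<close>, which leaves \<rho>.\<close>

lemma transported_step:
  assumes X: "X \<subseteq> {..<m} \<rightarrow>\<^sub>E D" and g: "iia_aggregator m X n g"
    and two: "\<And>j v. j < m \<Longrightarrow> v \<in> {..<n} \<rightarrow>\<^sub>E coord_values X j \<Longrightarrow> g j v = v p \<or> g j v = v q"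
    and pq: "p < n" "q < n" "p \<noteq> q"
    and i: "i < m" and l: "l < m"
    and edge: "blocked_edge m X (i, \<sigma>, \<sigma>') (l, \<rho>, \<rho>')"
    and tr: "transported X n p q g k u (i, \<sigma>, \<sigma>')"
  shows "transported X n p q g k u (l, \<rho>, \<rho>')"
proof -
  obtain V where V: "\<And>h x. h < n \<Longrightarrow> x \<in> X \<Longrightarrow> x k = u h \<Longrightarrow> x i \<in> V h"
    and gV: "\<And>v. v \<in> {..<n} \<rightarrow>\<^sub>E coord_values X i \<Longrightarrow> v p = \<sigma>' \<Longrightarrow> v q = \<sigma> \<Longrightarrow>
        (\<And>h. h < n \<Longrightarrow> h \<noteq> p \<Longrightarrow> h \<noteq> q \<Longrightarrow> v h \<in> V h) \<Longrightarrow> g i v = \<sigma>"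
    using tr by (auto simp: transported_def)
  obtain y z where yz: "y \<in> X" "z \<in> X" "y i = \<sigma>'" "y l = \<rho>'" "z i = \<sigma>" "z l = \<rho>"
    and blocked: "\<And>x. x \<in> X \<Longrightarrow> (\<And>j. j < m \<Longrightarrow> x j = y j \<or> x j = z j) \<Longrightarrow> x i = \<sigma> \<Longrightarrow> x l \<noteq> \<rho>'"
    using blocked_edge_witnesses[OF X edge] by metis
  define V' where "V' h = (\<lambda>x. x l) ` {x \<in> X. x i \<in> V h}" for h
  have "g l v = \<rho>"
    if v: "v \<in> {..<n} \<rightarrow>\<^sub>E coord_values X l" "v p = \<rho>'" "v q = \<rho>"
      and vV: "\<And>h. h < n \<Longrightarrow> h \<noteq> p \<Longrightarrow> h \<noteq> q \<Longrightarrow> v h \<in> V' h" for v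
  proof -
    \<comment> \<open>Lift the column \<open>v\<close> at \<open>l\<close> to a profile of tuples of
      \<open>X\<close> whose entries at \<open>i\<close> satisfy the conditions of
      \<open>gV\<close>.\<close>
    have "\<exists>x\<in>X. x l = v h \<and> (h = p \<longrightarrow> x = y) \<and> (h = q \<longrightarrow> x = z) \<and>
        (h \<noteq> p \<longrightarrow> h \<noteq> q \<longrightarrow> x i \<in> V h)" if "h < n" for h
      using yz v pq vV[OF that] by (cases "h = p"; cases "h = q") (auto simp: V'_def)
    then obtain \<xi> where \<xi>: "\<And>h. h < n \<Longrightarrow> \<xi> h \<in> X" "\<And>h. h < n \<Longrightarrow> \<xi> h l = v h"
      "\<xi> p = y" "\<xi> q = z" "\<And>h. h < n \<Longrightarrow> h \<noteq> p \<Longrightarrow> h \<noteq> q \<Longrightarrow> \<xi> h i \<in> V h"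
      using pq by metis
    define x where "x = (\<lambda>j\<in>{..<m}. g j (\<lambda>h\<in>{..<n}. \<xi> h j))"
    have "x \<in> X" unfolding x_def by (intro iia_aggregator_outcome[OF g] \<xi>(1))
    have col: "(\<lambda>h\<in>{..<n}. \<xi> h j) \<in> {..<n} \<rightarrow>\<^sub>E coord_values X j" for j
      using \<xi>(1) by (auto intro: coord_valuesI)
    have "x j = y j \<or> x j = z j" if "j < m" for j
      using two[OF that col] that \<xi>(3,4) pq by (auto simp: x_def)
    moreover have "x i = \<sigma>"
      using gV[OF col] \<xi>(3-5) pq yz i by (simp add: x_def)
    ultimately have "x l \<noteq> \<rho>'" using blocked \<open>x \<in> X\<close> by blast
    moreover have "(\<lambda>h\<in>{..<n}. \<xi> h l) = v"
      using \<xi>(2) v(1) by (auto simp: fun_eq_iff PiE_iff extensional_def)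
    ultimately show ?thesis using two[OF l v(1)] v l by (auto simp: x_def)
  qed
  moreover have "x l \<in> V' h" if "h < n" "x \<in> X" "x k = u h" for h x
    using V[OF that] that by (auto simp: V'_def)
  ultimately show ?thesis
    unfolding transported_def by (auto intro!: exI[of _ V'])
qed

lemma totally_blocked_supportive_semiprojection:
  assumes X: "X \<subseteq> {..<m} \<rightarrow>\<^sub>E D" and blocked: "totally_blocked m X" and n: "n \<ge> 3"
    and f: "iia_aggregator m X n f" "supportive m X n f" and semi: "semiprojection m X n p f"
  shows "dictatorship m X n f"
proof (rule ccontr)
  have p: "p < n" using semi by (simp add: semiprojection_def)
  assume "\<not> dictatorship m X n f"
  then obtain k u where k: "k < m" and u: "u \<in> {..<n} \<rightarrow>\<^sub>E coord_values X k" and ne: "f k u \<noteq> u p"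
    using p by (auto simp: dictatorship_def)
  have inj: "inj_on u {..<n}"
    using semiprojectionD[OF semi k u] ne by blast
  have "f k u \<in> u ` {..<n}" using f(2) k u by (auto simp: supportive_def)
  then obtain q where q: "q < n" "f k u = u q" by auto
  then have "q \<noteq> p" using ne by auto
  obtain g where g: "iia_aggregator m X n g" "semiprojection m X n p g"
    and two: "\<And>j v. j < m \<Longrightarrow> v \<in> {..<n} \<rightarrow>\<^sub>E coord_values X j \<Longrightarrow> g j v = v p \<or> g j v = v q"
    and gq: "\<And>j v. j < m \<Longrightarrow> v \<in> {..<n} \<rightarrow>\<^sub>E coord_values X j \<Longrightarrow> f j v = v q \<Longrightarrow> g j v = v q"
    using semiprojection_two_valued[OF X f semi q(1) \<open>q \<noteq> p\<close>] by metis
  \<comment> \<open>The bound \<open>n \<ge> 3\<close> leaves room for a third voter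
    \<open>r\<close>.\<close>
  have "\<not> {..<n} \<subseteq> {p, q}"
  proof
    assume "{..<n} \<subseteq> {p, q}"
    then have "card {..<n} \<le> card {p, q}" by (intro card_mono) auto
    with n \<open>q \<noteq> p\<close> show False by simp
  qed
  then obtain r where r: "r < n" "r \<noteq> p" "r \<noteq> q" by auto
  have mem: "u h \<in> coord_values X k" if "h < n" for h
    using u that by auto
  have distinct: "u q \<noteq> u p" "u q \<noteq> u r"
    using inj p q r \<open>q \<noteq> p\<close> by (auto simp: inj_on_def)
  let ?G = "blockedness_graph m X"
  have "((k, u q, u p), (k, u q, u r)) \<in> rtrancl_on (pverts ?G) (parcs ?G)"
    using blocked mem p q r distinct k
    by (auto simp: totally_blocked_def strongly_connected_def reachable_def
      blockedness_graph_def Let_def)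
  then have "transported X n p q g k u (k, u q, u r)"
  proof (induction rule: rtrancl_on_induct)
    case base
    have "g k v = u q"
      if v: "v \<in> {..<n} \<rightarrow>\<^sub>E coord_values X k" "v p = u p" "v q = u q"
        "\<And>h. h < n \<Longrightarrow> h \<noteq> p \<Longrightarrow> h \<noteq> q \<Longrightarrow> v h \<in> {u h}" for v
    proof -
      have "v i = u i" if "i < n" for i
        using v(2-4) that by (cases "i = p"; cases "i = q") auto
      then have "v = u" by (intro PiE_ext[OF v(1) u]) auto
      then show ?thesis using gq[OF k u] q by simp
    qed
    then show ?case
      unfolding transported_def by (auto intro!: exI[of _ "\<lambda>h. {u h}"])
  next
    case (step v w)
    obtain i \<sigma> \<sigma>' l \<rho> \<rho>' where vw: "v = (i, \<sigma>, \<sigma>')" "w = (l, \<rho>, \<rho>')"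
      by (metis prod.exhaust)
    have "i < m" "l < m" and edge: "blocked_edge m X (i, \<sigma>, \<sigma>') (l, \<rho>, \<rho>')"
      using step.hyps(2) unfolding vw blockedness_graph_def Let_def by simp_all
    then show ?case
      unfolding vw
      using transported_step[OF X g(1) two p q(1) \<open>q \<noteq> p\<close>[symmetric] _ _ edge] step.IH[unfolded vw]
      by blast
  qed
  then obtain V where V: "\<forall>h<n. \<forall>x\<in>X. x k = u h \<longrightarrow> x k \<in> V h"
    and gV: "\<forall>v \<in> {..<n} \<rightarrow>\<^sub>E coord_values X k. v p = u r \<longrightarrow> v q = u q \<longrightarrow>
        (\<forall>h<n. h \<noteq> p \<longrightarrow> h \<noteq> q \<longrightarrow> v h \<in> V h) \<longrightarrow> g k v = u q"
    unfolding transported_def split by (elim exE conjE)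
  \<comment> \<open>The path returns to \<open>k\<close>, and any tuple of \<open>X\<close> with
    value \<open>u h\<close> there puts \<open>u h\<close> into \<open>V h\<close>. So the voters
    other than \<open>p\<close> and \<open>q\<close> may keep their votes from
    \<open>u\<close>.\<close>
  have uV: "u h \<in> V h" if "h < n" for h
    using V mem[OF that] that by (fastforce simp: coord_values_def)
  \<comment> \<open>Now \<open>p\<close> copies \<open>r\<close>: transport makes \<open>q\<close>
    decide, whereas the repeated value makes \<open>p\<close> decide.\<close>
  let ?v = "u(p := u r)"
  have v: "?v \<in> {..<n} \<rightarrow>\<^sub>E coord_values X k"
    using u p r by (auto simp: PiE_iff extensional_def)
  have "g k ?v = u q"
    using \<open>q \<noteq> p\<close> uV by (intro gV[rule_format, OF v]) auto
  moreover have "?v p = ?v r" using r by simp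
  then have "\<not> inj_on ?v {..<n}"
    using p r unfolding inj_on_def by blast
  then have "g k ?v = u r"
    using semiprojectionD[OF g(2) k v] by simp
  ultimately show False using distinct by simp
qed

subsection \<open>Reduction of the arity\<close>

text \<open>If every merging into \<open>n - 1\<close> voters were dictatorial, \<open>f\<close>
  would be a semiprojection, and total blockedness would make it a dictatorship.\<close>

lemma supp_nondict_reduce_arity:
  assumes X: "X \<subseteq> {..<m} \<rightarrow>\<^sub>E D" "m \<ge> 1" "non_degenerate m X" "totally_blocked m X"
    and n: "n \<ge> 4" and has: "has_supp_nondict_aggregator m X n"
  shows "has_supp_nondict_aggregator m X (n - 1)"
proof (rule ccontr)
  assume no: "\<not> has_supp_nondict_aggregator m X (n - 1)"
  obtain f where f: "iia_aggregator m X n f" "supportive m X n f" "\<not> dictatorship m X n f"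
    using has by (auto simp: has_supp_nondict_aggregator_def)
  have "dictatorship m X (n - 1) (compose_aggregator n f (\<lambda>i j v. v (e i)))"
    if "\<And>i. i < n \<Longrightarrow> e i < n - 1" for e
  proof -
    have "iia_aggregator m X (n - 1) (compose_aggregator n f (\<lambda>i j v. v (e i)))"
      using n that by (intro iia_aggregator_compose f projection_aggregator[OF X(1)]) auto
    moreover have "supportive m X (n - 1) (compose_aggregator n f (\<lambda>i j v. v (e i)))"
      using that by (intro supportive_compose f projection_aggregator[OF X(1)]) auto
    ultimately show ?thesis using no by (auto simp: has_supp_nondict_aggregator_def)
  qed
  then obtain p where "semiprojection m X n p f"
    using semiprojection_of_minimal_arity[OF X(1-3) n] by blast
  then show False
    using totally_blocked_supportive_semiprojection[OF X(1,4) _ f(1,2)] n f(3) by auto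
qed

text \<open>With more voters than elements of \<open>D\<close>, every tuple of votes repeats a
  value, so a semiprojection is already a dictatorship.\<close>

lemma idem_nondict_reduce_arity:
  assumes X: "X \<subseteq> {..<m} \<rightarrow>\<^sub>E D" "m \<ge> 1" "non_degenerate m X"
    and n: "n \<ge> 4" "n > card D" "finite D" and has: "has_idem_nondict_aggregator m X n"
  shows "has_idem_nondict_aggregator m X (n - 1)"
proof (rule ccontr)
  assume no: "\<not> has_idem_nondict_aggregator m X (n - 1)"
  obtain f where f: "iia_aggregator m X n f" "idempotent m X n f" "\<not> dictatorship m X n f"
    using has by (auto simp: has_idem_nondict_aggregator_def)
  have "dictatorship m X (n - 1) (compose_aggregator n f (\<lambda>i j v. v (e i)))"
    if "\<And>i. i < n \<Longrightarrow> e i < n - 1" for e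
  proof -
    have "iia_aggregator m X (n - 1) (compose_aggregator n f (\<lambda>i j v. v (e i)))"
      using n that by (intro iia_aggregator_compose f projection_aggregator[OF X(1)]) auto
    moreover have "idempotent m X (n - 1) (compose_aggregator n f (\<lambda>i j v. v (e i)))"
      using that by (intro idempotent_compose f projection_aggregator[OF X(1)]) auto
    ultimately show ?thesis using no by (auto simp: has_idem_nondict_aggregator_def)
  qed
  then obtain p where p: "semiprojection m X n p f"
    using semiprojection_of_minimal_arity[OF X n(1)] by blast
  have "\<not> inj_on u {..<n}" if "j < m" "u \<in> {..<n} \<rightarrow>\<^sub>E coord_values X j" for j u
  proof
    assume "inj_on u {..<n}"
    moreover have "coord_values X j \<subseteq> D"
      using X(1) \<open>j < m\<close> by (auto simp: coord_values_def)
    then have "u ` {..<n} \<subseteq> D" using that(2) by auto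
    ultimately have "card {..<n} \<le> card D"
      using n(3) by (metis card_inj_on_le)
    with n(2) show False by simp
  qed
  then have "dictatorship m X n f"
    using p unfolding semiprojection_def dictatorship_def by blast
  with f(3) show False ..
qed

lemma descend_to_bound:
  fixes P :: "nat \<Rightarrow> bool"
  assumes "\<And>n. n > N \<Longrightarrow> P n \<Longrightarrow> P (n - 1)" "P n"
  shows "\<exists>n\<le>N. P n"
  using assms(2)
proof (induction n)
  case (Suc n)
  then show ?case using assms(1)[of "Suc n"] by (cases "Suc n \<le> N") auto
qed auto

theorem theorem5:
  fixes D :: "'a set" and m :: nat and X :: "(nat \<Rightarrow> 'a) set"
  assumes "finite D"
    and "m \<ge> 1"
    and "X \<subseteq> {..<m} \<rightarrow>\<^sub>E D"
    and "non_degenerate m X"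
    and "non_binary m X"
    and "totally_blocked m X"
  shows "(supportive_impossibility_domain m X \<longleftrightarrow>
            \<not> (\<exists>n. n \<le> 3 \<and> has_supp_nondict_aggregator m X n)) \<and>
         (idempotent_impossibility_domain m X \<longleftrightarrow>
            \<not> (\<exists>n. n \<le> card D \<and> has_idem_nondict_aggregator m X n))"
proof -
  \<comment> \<open>This makes \<open>n > card D\<close> imply \<open>n \<ge> 4\<close>, as the
    idempotent reduction requires.\<close>
  have "card D \<ge> 3"
  proof -
    obtain j where j: "j < m" "card (coord_values X j) > 2"
      using assms(5) by (auto simp: non_binary_def)
    then have "coord_values X j \<subseteq> D"
      using assms(3) by (auto simp: coord_values_def)
    then have "card (coord_values X j) \<le> card D"
      using assms(1) by (rule card_mono[rotated])
    with j(2) show ?thesis by simp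
  qed
  then have idem: "(\<exists>n\<le>card D. has_idem_nondict_aggregator m X n)"
    if "has_idem_nondict_aggregator m X n" for n
    using that assms by (intro descend_to_bound idem_nondict_reduce_arity) auto
  have supp: "(\<exists>n\<le>3. has_supp_nondict_aggregator m X n)"
    if "has_supp_nondict_aggregator m X n" for n
    using that assms by (intro descend_to_bound supp_nondict_reduce_arity) auto
  have idem2: "n \<ge> 2" if "has_idem_nondict_aggregator m X n" for n
    using that nondict_aggregator_arity by (auto simp: has_idem_nondict_aggregator_def)
  have supp2: "n \<ge> 2" if "has_supp_nondict_aggregator m X n" for n
    using that nondict_aggregator_arity supportive_imp_idempotent
    by (fastforce simp: has_supp_nondict_aggregator_def)
  show ?thesis
    unfolding supportive_impossibility_domain_def supportive_possibility_domain_def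
      idempotent_impossibility_domain_def idempotent_possibility_domain_def
    using idem supp idem2 supp2 by metis
qed

end
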